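(* For every real $\kappa\in[1,\infty)$, every positive integer $d$, and every set $A\subseteq\{0,1\}^d$ one has \[ \widetilde{E}_{\kappa}(A) \leq |A|^{\widetilde{r}}, \qquad\text{where } \widetilde{r}=\widetilde{r}(\kappa) := \log_2(2^\kappa+2). \] Besides the trivial cases $|A|\leq 1$, equality is also attained for some sets with $|A|>1$; for example, it is attained when $A=\{0,1\}^d$.
   Context: For a real number $\kappa\in[1,\infty)$ and a finite set $A\subset\mathbb{Z}^d$, \[ \widetilde{E}_{\kappa}(A) := \big\|\mathbf{1}_A \ast\widetilde{\mathbf{1}}_A\big\|_{\ell^\kappa(\mathbb{Z}^d)}^{\kappa}, \] where $\mathbf{1}_A$ is the indicator function of $A$ on $\mathbb{Z}^d$, $\widetilde{f}(x):=f(-x)$ for $x\in\mathbb{Z}^d$ denotes the reflection of $f$, and $(f\ast g)(x) := \sum_{y\in\mathbb{Z}^d} f(x-y) g(y)$. $|A|$ denotes the cardinality of $A$. *)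

theory Defs
  imports "HOL-Analysis.Analysis"
begin

text \<open>
  The lattice \<open>\<int>\<^sup>d\<close> is the type \<^typ>\<open>int ^ 'n\<close> with \<open>d = CARD('n)\<close>; index types are nonempty,
  so \<open>d\<close> ranges over exactly the positive integers. Sums over the lattice are unconditional
  sums, with value 0 when not summable; for indicators of finite sets all sums below
  have finite support.
\<close>

definition reflection :: "(int ^ 'n \<Rightarrow> real) \<Rightarrow> int ^ 'n \<Rightarrow> real" where
  "reflection f = (\<lambda>x. f (- x))"

definition convolution ::
    "(int ^ 'n \<Rightarrow> real) \<Rightarrow> (int ^ 'n \<Rightarrow> real) \<Rightarrow> int ^ 'n \<Rightarrow> real" where
  "convolution f g = (\<lambda>x. \<Sum>\<^sub>\<infinity>y. f (x - y) * g y)"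

definition lp_norm :: "real \<Rightarrow> (int ^ 'n \<Rightarrow> real) \<Rightarrow> real" where
  "lp_norm p f = (\<Sum>\<^sub>\<infinity>x. \<bar>f x\<bar> powr p) powr (1 / p)"

definition energy :: "real \<Rightarrow> (int ^ 'n) set \<Rightarrow> real" where
  "energy \<kappa> A = lp_norm \<kappa> (convolution (indicator A) (reflection (indicator A))) powr \<kappa>"

definition cube :: "(int ^ 'n) set" where
  "cube = {x. \<forall>i. x $ i \<in> {0, 1}}"

definition r_exponent :: "real \<Rightarrow> real" where
  "r_exponent \<kappa> = log 2 (2 powr \<kappa> + 2)"

end

theory Submission
  imports Defs "HOL-Real_Asymp.Real_Asymp"
begin

text \<open>
  Put \<open>q = r / 2\<close> for \<open>r = log\<^sub>2 (2\<^sup>\<kappa> + 2)\<close> and count, for two sets, the representations of \<open>x\<close> as \<open>a - b\<close>.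
  The bilinear bound \<open>\<Sum>\<^sub>x rep A B x\<^sup>\<kappa> \<le> (|A| |B|)\<^sup>q\<close> is stable under adding a coordinate: splitting
  \<open>A = A\<^sub>0 \<union> A\<^sub>1\<close> and \<open>B = B\<^sub>0 \<union> B\<^sub>1\<close> along it and using Minkowski's inequality for the
  overlapping contributions of \<open>(A\<^sub>0, B\<^sub>0)\<close> and \<open>(A\<^sub>1, B\<^sub>1)\<close>, it reduces to
  \<open>U\<^sup>q + V\<^sup>q + (X\<^bsup>q/\<kappa>\<^esup> + Y\<^bsup>q/\<kappa>\<^esup>)\<^sup>\<kappa> \<le> (X + Y + U + V)\<^sup>q\<close> whenever \<open>X Y = U V\<close>.
  In hyperbolic coordinates log-concavity of \<open>sinh\<close> reduces this to \<open>U = V\<close>, that is, to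
  \<open>(2 cosh s)\<^sup>\<kappa> + 2 \<le> (2 cosh (\<kappa> s / r))\<^sup>r\<close>. The two sides agree at \<open>s = 0\<close> and asymptotically as \<open>s\<close>
  tends to infinity, and the derivative of their log-quotient changes sign at most once,
  from positive to negative.
\<close>

section \<open>Log-concavity of sinh and the reduction to equal cross terms\<close>

text \<open>By the mean value theorem each increment is a value of \<open>t * coth (x * t)\<close>,
  on the left at a larger argument than on the right, and coth decreases. This is log-concavity of
  sinh in slope form, with denominators cleared.\<close>

lemma ln_sinh_increment_le:
  fixes a b c d t :: real
  assumes "0 < a" "a < b" "b \<le> c" "c < d" "0 < t"
  shows "(ln (sinh (d * t)) - ln (sinh (c * t))) * (b - a) \<le> (ln (sinh (b * t)) - ln (sinh (a * t))) * (d - c)"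
proof -
  let ?f = "\<lambda>x. ln (sinh (x * t))" and ?g = "\<lambda>x. t * (cosh (x * t) / sinh (x * t))"
  have der: "(?f has_real_derivative ?g x) (at x)" if "x > 0" for x
  proof -
    have "sinh (x * t) > 0" using that assms by simp
    then show ?thesis
      by (auto intro!: derivative_eq_intros)
  qed
  obtain u where u: "a < u" "u < b" "?f b - ?f a = (b - a) * ?g u"
    using MVT2[of a b ?f ?g] der assms by force
  obtain v where v: "c < v" "v < d" "?f d - ?f c = (d - c) * ?g v"
    using MVT2[of c d ?f ?g] der assms by force
  have uv: "0 < u * t" "u * t \<le> v * t" using u v assms by auto
  have "cosh (v * t) * sinh (u * t) \<le> cosh (u * t) * sinh (v * t)"
  proof -
    have "0 \<le> sinh (v * t - u * t)" using uv by simp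
    then show ?thesis by (simp add: sinh_diff algebra_simps)
  qed
  then have "cosh (v * t) / sinh (v * t) \<le> cosh (u * t) / sinh (u * t)"
    using uv by (simp add: divide_simps)
  then have "?g v \<le> ?g u" using \<open>0 < t\<close> by (intro mult_left_mono) auto
  then have "?g v * ((d - c) * (b - a)) \<le> ?g u * ((d - c) * (b - a))"
    using assms by (intro mult_right_mono) auto
  then show ?thesis unfolding u v by (simp only: mult_ac)
qed

text \<open>In the factor x, the slope of \<open>ln (sinh (x * t))\<close> on [2, n] is at most its
  slope on [1, 2], which is \<open>ln (2 * cosh t)\<close> by the double-angle formula. For n = 2
  there is equality.\<close>

lemma sinh_mult_le:
  fixes n t :: real
  assumes "n \<ge> 2" "t \<ge> 0"
  shows "sinh (n * t) \<le> sinh t * (2 * cosh t) powr (n - 1)"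
proof (cases "t = 0 \<or> n = 2")
  case True
  then show ?thesis by (auto simp: sinh_double)
next
  case False
  then have t: "t > 0" and n: "n > 2" using assms by auto
  have "ln (sinh (n * t)) - ln (sinh (2 * t)) \<le> (ln (sinh (2 * t)) - ln (sinh t)) * (n - 2)"
    using ln_sinh_increment_le[of 1 2 2 n t] t n by simp
  moreover have "ln (sinh (2 * t)) = ln (sinh t) + ln (2 * cosh t)"
    using t by (simp add: sinh_double ln_mult)
  ultimately have "ln (sinh (n * t)) \<le> ln (sinh t) + (n - 1) * ln (2 * cosh t)"
    by (simp add: algebra_simps)
  also have "\<dots> = ln (sinh t * (2 * cosh t) powr (n - 1))"
    using t by (simp add: ln_mult ln_powr)
  finally show ?thesis using t n by (subst (asm) ln_le_cancel_iff) auto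
qed

text \<open>Both sides are even in t and agree at t = 0, so comparing derivatives for nonnegative t
  suffices. With W = 2 cosh z this passes from t = 0, the case of equal cross terms, to arbitrary
  t.\<close>

lemma add_cosh_mult_le_powr:
  fixes W q t :: real
  assumes "W \<ge> 2" "q \<ge> 1"
  shows "(W + 2) powr q + 2 * cosh (q * t) \<le> (W + 2 * cosh t) powr q + 2"
proof -
  have main: "(W + 2) powr q + 2 * cosh (q * t) \<le> (W + 2 * cosh t) powr q + 2" if "t \<ge> 0" for t
  proof -
    let ?f = "\<lambda>t. (W + 2 * cosh t) powr q - 2 * cosh (q * t)"
    have "?f 0 \<le> ?f t"
    proof (rule DERIV_nonneg_imp_nondecreasing[OF that])
      fix x :: real assume x: "0 \<le> x" "x \<le> t"
      have W: "W + 2 * cosh x > 0" using assms cosh_real_pos[of x] by linarith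
      have "(?f has_real_derivative q * (W + 2 * cosh x) powr (q - 1) * (2 * sinh x) - 2 * (q * sinh (q * x))) (at x)"
        using W by (auto intro!: derivative_eq_intros)
      moreover have "0 \<le> q * (W + 2 * cosh x) powr (q - 1) * (2 * sinh x) - 2 * (q * sinh (q * x))"
      proof -
        \<comment> \<open>Working at x / 2 with n = 2q turns the base into a square: (2 cosh
          (x/2))^2 = 2 + 2 cosh x, which W >= 2 allows to enlarge to W + 2 cosh x.\<close>
        have "sinh (2 * q * (x / 2)) \<le> sinh (x / 2) * (2 * cosh (x / 2)) powr (2 * q - 1)"
          using x assms by (intro sinh_mult_le) auto
        also have "(2 * cosh (x / 2)) powr (2 * q - 1) = (2 * cosh (x / 2)) powr (2 * (q - 1) + 1)"
          by simp
        also have "\<dots> = ((2 * cosh (x / 2)) powr 2) powr (q - 1) * (2 * cosh (x / 2))"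
          by (subst powr_add) (simp add: powr_powr del: powr_numeral)
        also have "(2 * cosh (x / 2)) powr 2 = 2 + 2 * cosh x"
          using cosh_double_cosh[of "x / 2"] by (simp add: power2_eq_square)
        also have "sinh (x / 2) * ((2 + 2 * cosh x) powr (q - 1) * (2 * cosh (x / 2))) = sinh x * (2 + 2 * cosh x) powr (q - 1)"
          using sinh_double[of "x / 2"] by simp
        also have "\<dots> \<le> sinh x * (W + 2 * cosh x) powr (q - 1)"
          using x assms by (intro mult_left_mono powr_mono2) auto
        finally have "sinh (q * x) \<le> sinh x * (W + 2 * cosh x) powr (q - 1)" by simp
        then have "2 * q * sinh (q * x) \<le> 2 * q * (sinh x * (W + 2 * cosh x) powr (q - 1))"
          using assms by (intro mult_left_mono) auto
        then show ?thesis by (simp add: algebra_simps)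
      qed
      ultimately show "\<exists>y. (?f has_real_derivative y) (at x) \<and> 0 \<le> y" by blast
    qed
    then show ?thesis by simp
  qed
  show ?thesis using main[of t] main[of "-t"] by (cases "t \<ge> 0") auto
qed

section \<open>The one-variable inequality between powers of cosh\<close>

lemma sinh_le_mult_cosh:
  fixes u :: real
  assumes "0 \<le> u"
  shows "sinh u \<le> u * cosh u"
proof -
  have "0 * cosh 0 - sinh 0 \<le> u * cosh u - sinh u"
  proof (rule DERIV_nonneg_imp_nondecreasing[OF assms])
    fix x :: real assume "0 \<le> x"
    then show "\<exists>y. ((\<lambda>x. x * cosh x - sinh x) has_real_derivative y) (at x) \<and> 0 \<le> y"
      by (intro exI[of _ "x * sinh x"]) (auto intro!: derivative_eq_intros)
  qed
  then show ?thesis by simp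
qed

text \<open>The derivative in the factor x is coth(xs) - xs / sinh(xs)^2 - tanh s. Since coth - tanh
  = 1 / (sinh cosh) and sinh u <= u cosh u, the first two terms are at most tanh(xs), hence at most
  tanh s because x <= 1.\<close>

lemma mult_coth_diff_le:
  fixes a b s :: real
  assumes "0 < a" "a \<le> b" "b \<le> 1" "0 < s"
  shows "b * (cosh (b * s) / sinh (b * s)) - b * tanh s \<le> a * (cosh (a * s) / sinh (a * s)) - a * tanh s"
proof (rule DERIV_nonpos_imp_nonincreasing[OF \<open>a \<le> b\<close>])
  fix x assume x: "a \<le> x" "x \<le> b"
  let ?d = "cosh (x * s) / sinh (x * s) - x * s / (sinh (x * s))\<^sup>2 - tanh s"
  have sh: "sinh (x * s) > 0" using x assms by simp
  have "((\<lambda>x. x * (cosh (x * s) / sinh (x * s)) - x * tanh s) has_real_derivative ?d) (at x)"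
  proof -
    have "((\<lambda>x. cosh (x * s) / sinh (x * s)) has_real_derivative
        (sinh (x * s) * s * sinh (x * s) - cosh (x * s) * (cosh (x * s) * s)) / (sinh (x * s) * sinh (x * s))) (at x)"
      using sh by (auto intro!: derivative_eq_intros)
    also have "(sinh (x * s) * s * sinh (x * s) - cosh (x * s) * (cosh (x * s) * s)) / (sinh (x * s) * sinh (x * s))
        = - s / (sinh (x * s))\<^sup>2"
      using cosh_square_eq[of "x * s"] by (simp add: power2_eq_square algebra_simps)
    finally have "((\<lambda>x. cosh (x * s) / sinh (x * s)) has_real_derivative - s / (sinh (x * s))\<^sup>2) (at x)" .
    from DERIV_diff[OF DERIV_mult[OF DERIV_ident this] DERIV_cmult_right[OF DERIV_ident, of "tanh s"]]
    show ?thesis by (simp add: algebra_simps)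
  qed
  moreover have "?d \<le> 0"
  proof -
    have "sinh (x * s) \<le> x * s * cosh (x * s)"
      using x assms by (intro sinh_le_mult_cosh) auto
    then have "1 / (sinh (x * s) * cosh (x * s)) \<le> x * s / (sinh (x * s))\<^sup>2"
      using sh by (simp add: field_simps power2_eq_square)
    moreover have "cosh (x * s) / sinh (x * s) - tanh (x * s) = 1 / (sinh (x * s) * cosh (x * s))"
      using x assms cosh_square_eq[of "x * s"] by (simp add: tanh_def diff_frac_eq power2_eq_square)
    ultimately have "cosh (x * s) / sinh (x * s) - x * s / (sinh (x * s))\<^sup>2 \<le> tanh (x * s)"
      by linarith
    also have "\<dots> \<le> tanh s" using x assms by simp
    finally show ?thesis by simp
  qed
  ultimately show "\<exists>y. ((\<lambda>x. x * (cosh (x * s) / sinh (x * s)) - x * tanh s) has_real_derivative y) (at x) \<and> y \<le> 0"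
    by blast
qed

text \<open>With P = 2^\<kappa> >= 2, the upper bound on q is P + 2 <= P^2, that is, (P - 2)(P + 1)
  >= 0. The three bounds place \<rho> = \<kappa> / (2q) in [1/2, 1) and give 2\<rho> <=
  \<kappa>.\<close>

lemma exponent_bounds:
  fixes \<kappa> q :: real
  assumes "\<kappa> \<ge> 1" and q: "2 powr \<kappa> + 2 = 2 powr (2 * q)"
  shows "1 \<le> q" "q \<le> \<kappa>" "\<kappa> < 2 * q"
proof -
  have two: "2 \<le> 2 powr \<kappa>" using assms(1) powr_mono[of 1 \<kappa> 2] by simp
  then have "2 powr 2 \<le> 2 powr (2 * q)" unfolding q[symmetric] by simp
  then show "1 \<le> q" by (subst (asm) powr_le_cancel_iff) auto
  have "0 \<le> (2 powr \<kappa> - 2) * (2 powr \<kappa> + 1)" using two by simp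
  then have "2 powr \<kappa> + 2 \<le> 2 powr \<kappa> * 2 powr \<kappa>" by (simp add: algebra_simps)
  also have "\<dots> = 2 powr (2 * \<kappa>)" by (simp flip: powr_add)
  finally have "2 powr (2 * q) \<le> 2 powr (2 * \<kappa>)" unfolding q .
  then show "q \<le> \<kappa>" by (subst (asm) powr_le_cancel_iff) auto
  have "2 powr \<kappa> < 2 powr (2 * q)" unfolding q[symmetric] by simp
  then show "\<kappa> < 2 * q" by (subst (asm) powr_less_cancel_iff) auto
qed

text \<open>This function governs the sign of the derivative of the log-quotient. Its own derivative
  is at least (\<kappa> - 2\<rho>) tanh x, by \<open>mult_coth_diff_le\<close> for the factors 1 -
  \<rho> <= \<rho>.\<close>

lemma ln_sinh_quotient_mono:
  fixes \<rho> \<kappa> s t :: real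
  assumes \<rho>: "1 / 2 \<le> \<rho>" "\<rho> < 1" "2 * \<rho> \<le> \<kappa>" and st: "0 < s" "s \<le> t"
  shows "ln (sinh ((1 - \<rho>) * s)) - ln (sinh (\<rho> * s)) + (\<kappa> - 1) * ln (2 * cosh s)
       \<le> ln (sinh ((1 - \<rho>) * t)) - ln (sinh (\<rho> * t)) + (\<kappa> - 1) * ln (2 * cosh t)"
proof (rule DERIV_nonneg_imp_nondecreasing[OF \<open>s \<le> t\<close>])
  fix x :: real assume "s \<le> x" "x \<le> t"
  with st have x: "x > 0" by simp
  let ?f = "\<lambda>x. ln (sinh ((1 - \<rho>) * x)) - ln (sinh (\<rho> * x)) + (\<kappa> - 1) * ln (2 * cosh x)"
  let ?d = "(1 - \<rho>) * (cosh ((1 - \<rho>) * x) / sinh ((1 - \<rho>) * x)) - \<rho> * (cosh (\<rho> * x) / sinh (\<rho> * x)) + (\<kappa> - 1) * tanh x"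
  have sh: "sinh ((1 - \<rho>) * x) > 0" "sinh (\<rho> * x) > 0" using x \<rho> by auto
  have c: "((\<lambda>x. ln (sinh (c * x))) has_real_derivative c * (cosh (c * x) / sinh (c * x))) (at x)"
    if "sinh (c * x) > 0" for c using that by (auto intro!: derivative_eq_intros)
  have "((\<lambda>x. ln (2 * cosh x)) has_real_derivative tanh x) (at x)"
    by (auto intro!: derivative_eq_intros simp: tanh_def)
  then have "(?f has_real_derivative ?d) (at x)"
    by (intro DERIV_add DERIV_diff c sh DERIV_cmult)
  moreover have "?d \<ge> 0"
  proof -
    have "\<rho> * (cosh (\<rho> * x) / sinh (\<rho> * x)) - \<rho> * tanh x
        \<le> (1 - \<rho>) * (cosh ((1 - \<rho>) * x) / sinh ((1 - \<rho>) * x)) - (1 - \<rho>) * tanh x"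
      using \<rho> x by (intro mult_coth_diff_le) auto
    then have "(\<kappa> - 2 * \<rho>) * tanh x \<le> ?d" by (simp add: algebra_simps)
    moreover have "0 \<le> (\<kappa> - 2 * \<rho>) * tanh x" using \<rho> x by simp
    ultimately show ?thesis by linarith
  qed
  ultimately show "\<exists>y. (?f has_real_derivative y) (at x) \<and> 0 \<le> y" by blast
qed

text \<open>With P = (2 cosh s)^\<kappa>, clearing denominators and using the subtraction formula
  for sinh gives 2 cosh s sinh(\<rho>s) < P sinh((1 - \<rho>)s); then take logarithms.\<close>

lemma tanh_quotient_less_iff:
  fixes \<rho> \<kappa> s :: real
  assumes "0 < \<rho>" "\<rho> < 1" "0 < s"
  shows "tanh (\<rho> * s) < (2 * cosh s) powr \<kappa> * tanh s / ((2 * cosh s) powr \<kappa> + 2) \<longleftrightarrow>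
    0 < ln (sinh ((1 - \<rho>) * s)) - ln (sinh (\<rho> * s)) + (\<kappa> - 1) * ln (2 * cosh s)"
proof -
  define P where "P = (2 * cosh s) powr \<kappa>"
  have P: "P > 0" unfolding P_def by simp
  have sh: "0 < sinh (\<rho> * s)" "0 < sinh ((1 - \<rho>) * s)" using assms by auto
  have e: "sinh ((1 - \<rho>) * s) = sinh s * cosh (\<rho> * s) - cosh s * sinh (\<rho> * s)"
    by (simp add: sinh_diff left_diff_distrib)
  have "tanh (\<rho> * s) < P * tanh s / (P + 2) \<longleftrightarrow> sinh (\<rho> * s) * (2 * cosh s) < P * sinh ((1 - \<rho>) * s)"
    unfolding e using P by (simp add: tanh_def divide_simps) (simp add: algebra_simps)
  also have "\<dots> \<longleftrightarrow> ln (sinh (\<rho> * s) * (2 * cosh s)) < ln (P * sinh ((1 - \<rho>) * s))"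
    using sh P by (subst ln_less_cancel_iff) auto
  also have "\<dots> \<longleftrightarrow> 0 < ln (sinh ((1 - \<rho>) * s)) - ln (sinh (\<rho> * s)) + (\<kappa> - 1) * ln (2 * cosh s)"
    using sh P by (simp add: ln_mult P_def ln_powr) (auto simp: algebra_simps)
  finally show ?thesis unfolding P_def .
qed

lemma two_cosh_powr_add_two_le:
  fixes \<kappa> q s :: real
  assumes \<kappa>: "\<kappa> \<ge> 1" and q: "2 powr \<kappa> + 2 = 2 powr (2 * q)" and s: "s \<ge> 0"
  shows "(2 * cosh s) powr \<kappa> + 2 \<le> (2 * cosh (\<kappa> / (2 * q) * s)) powr (2 * q)"
proof -
  note b = exponent_bounds[OF \<kappa> q]
  define \<rho> where "\<rho> = \<kappa> / (2 * q)"
  have \<rho>: "1 / 2 \<le> \<rho>" "\<rho> < 1" "2 * \<rho> \<le> \<kappa>"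
    using b \<kappa> by (auto simp: \<rho>_def divide_simps)
  have q\<rho>: "2 * q * \<rho> = \<kappa>" using b by (simp add: \<rho>_def)
  \<comment> \<open>F is the logarithm of the right side over the left, F' its derivative, and H
    detects the sign: F' x < 0 exactly when H x > 0, for x > 0.\<close>
  define F where "F = (\<lambda>s. 2 * q * ln (2 * cosh (\<rho> * s)) - ln ((2 * cosh s) powr \<kappa> + 2))"
  define F' where "F' = (\<lambda>s. \<kappa> * (tanh (\<rho> * s) - (2 * cosh s) powr \<kappa> * tanh s / ((2 * cosh s) powr \<kappa> + 2)))"
  define H where "H = (\<lambda>s. ln (sinh ((1 - \<rho>) * s)) - ln (sinh (\<rho> * s)) + (\<kappa> - 1) * ln (2 * cosh s))"
  have F': "(F has_real_derivative F' x) (at x)" for x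
  proof -
    have p: "(2 * cosh x) powr \<kappa> + 2 > 0" by (simp add: add_pos_pos)
    have "((\<lambda>x. ln (2 * cosh (\<rho> * x))) has_real_derivative \<rho> * tanh (\<rho> * x)) (at x)"
      by (auto intro!: derivative_eq_intros simp: tanh_def)
    from DERIV_cmult[OF this, of "2 * q"]
    have 1: "((\<lambda>x. 2 * q * ln (2 * cosh (\<rho> * x))) has_real_derivative \<kappa> * tanh (\<rho> * x)) (at x)"
      by (simp add: q\<rho> flip: mult.assoc)
    have "((\<lambda>x. (2 * cosh x) powr \<kappa>) has_real_derivative \<kappa> * ((2 * cosh x) powr \<kappa> * tanh x)) (at x)"
      by (auto intro!: derivative_eq_intros simp: tanh_def powr_diff)
    from DERIV_chain2[OF DERIV_ln_divide[OF p] DERIV_add[OF this DERIV_const]]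
    have 2: "((\<lambda>x. ln ((2 * cosh x) powr \<kappa> + 2)) has_real_derivative
        \<kappa> * ((2 * cosh x) powr \<kappa> * tanh x) / ((2 * cosh x) powr \<kappa> + 2)) (at x)"
      by simp
    show ?thesis unfolding F_def F'_def using DERIV_diff[OF 1 2] by (simp add: algebra_simps)
  qed
  have iff: "F' x < 0 \<longleftrightarrow> 0 < H x" if "x > 0" for x
    using tanh_quotient_less_iff[of \<rho> x \<kappa>] \<kappa> \<rho> that
    unfolding F'_def H_def by (auto simp: mult_less_0_iff)
  have F0: "F 0 = 0" unfolding F_def by (simp add: q ln_powr)
  have "F s \<ge> 0"
  proof (rule ccontr)
    assume neg: "\<not> F s \<ge> 0"
    with F0 s have s: "s > 0" by (cases "s = 0") auto
    \<comment> \<open>Since F 0 = 0, a negative F s forces F' \<xi> < 0 at some \<xi> < s.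
      Monotonicity of H keeps F' negative from \<xi> on, so F stays below F s < 0 forever, against a
      lower bound that tends to 0.\<close>
    obtain \<xi> where \<xi>: "0 < \<xi>" "\<xi> < s" "F s - F 0 = (s - 0) * F' \<xi>"
      using MVT2[OF s, of F F'] F' by blast
    then have "F' \<xi> < 0" using neg F0 s by (simp add: mult_less_0_iff not_le)
    then have "0 < H \<xi>" using iff \<xi> by simp
    then have "0 < H x" if "x \<ge> \<xi>" for x
      using ln_sinh_quotient_mono[OF \<rho> \<open>0 < \<xi>\<close> that] unfolding H_def by linarith
    then have F'neg: "F' x \<le> 0" if "x \<ge> s" for x using iff[of x] \<xi> that by (simp add: less_imp_le)
    have dec: "F x \<le> F s" if "x \<ge> s" for x
      by (rule DERIV_nonpos_imp_nonincreasing[OF that]) (use F' F'neg in blast)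
    \<comment> \<open>Use 2 cosh(\<rho>x) >= exp(\<rho>x) and 2q\<rho> = \<kappa>, and pull
      exp(\<kappa>x) out of the other logarithm: the linear terms \<kappa>x cancel.\<close>
    have lower: "- ln ((1 + exp (- 2 * x)) powr \<kappa> + 2 * exp (- \<kappa> * x)) \<le> F x" for x
    proof -
      have "\<rho> * x \<le> ln (2 * cosh (\<rho> * x))"
        by (subst ln_ge_iff) (simp, simp add: cosh_def)
      then have 1: "\<kappa> * x \<le> 2 * q * ln (2 * cosh (\<rho> * x))"
        using b mult_left_mono[of "\<rho> * x" "ln (2 * cosh (\<rho> * x))" "2 * q"] by (simp add: q\<rho> flip: mult.assoc)
      have "2 * cosh x = exp x * (1 + exp (- 2 * x))"
        by (simp add: cosh_def algebra_simps flip: exp_add)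
      then have "(2 * cosh x) powr \<kappa> = exp (\<kappa> * x) * (1 + exp (- 2 * x)) powr \<kappa>"
        by (simp add: powr_mult exp_powr_real mult.commute)
      then have "(2 * cosh x) powr \<kappa> + 2 = exp (\<kappa> * x) * ((1 + exp (- 2 * x)) powr \<kappa> + 2 * exp (- \<kappa> * x))"
        by (simp add: algebra_simps flip: exp_add)
      moreover have "0 < (1 + exp (- 2 * x)) powr \<kappa> + 2 * exp (- \<kappa> * x)"
        by (simp add: add_nonneg_pos)
      ultimately have "ln ((2 * cosh x) powr \<kappa> + 2) = \<kappa> * x + ln ((1 + exp (- 2 * x)) powr \<kappa> + 2 * exp (- \<kappa> * x))"
        by (simp only: ln_mult_pos ln_exp exp_gt_zero)
      with 1 show ?thesis unfolding F_def by linarith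
    qed
    have "((\<lambda>x::real. - ln ((1 + exp (- 2 * x)) powr \<kappa> + 2 * exp (- \<kappa> * x))) \<longlongrightarrow> 0) at_top"
      using \<kappa> by real_asymp
    moreover have "eventually (\<lambda>x. - ln ((1 + exp (- 2 * x)) powr \<kappa> + 2 * exp (- \<kappa> * x)) \<le> F s) at_top"
      using eventually_ge_at_top[of s] by eventually_elim (use dec lower order_trans in blast)
    ultimately have "0 \<le> F s"
      by (intro tendsto_upperbound) auto
    with neg show False by simp
  qed
  then have "ln ((2 * cosh s) powr \<kappa> + 2) \<le> ln ((2 * cosh (\<rho> * s)) powr (2 * q))"
    by (simp add: F_def ln_powr)
  then show ?thesis unfolding \<rho>_def by (subst (asm) ln_le_cancel_iff) (auto simp: add_pos_pos)
qed

section \<open>Convexity of powers and Minkowski's inequality\<close>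

text \<open>At an endpoint 0 convexity amounts to c^p <= c for 0 < c < 1; positive points are
  covered by \<open>powr_convex\<close>.\<close>

lemma convex_on_powr_nonneg:
  fixes p :: real
  assumes "1 \<le> p"
  shows "convex_on {0..} (\<lambda>x. x powr p)"
proof (rule convex_onI)
  fix t x y :: real assume t: "0 < t" "t < 1" and xy: "x \<in> {0..}" "y \<in> {0..}"
  have scale: "(c * z) powr p \<le> c * z powr p" if "0 < c" "c < 1" "0 \<le> z" for c z :: real
  proof -
    have "c powr p \<le> c powr 1" using that assms by (intro powr_mono') auto
    then show ?thesis using that by (simp add: powr_mult mult_right_mono)
  qed
  show "((1 - t) *\<^sub>R x + t *\<^sub>R y) powr p \<le> (1 - t) * x powr p + t * y powr p"
  proof (cases "x = 0 \<or> y = 0")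
    case True
    then show ?thesis using scale[of t y] scale[of "1 - t" x] t xy by auto
  next
    case False
    then show ?thesis using convex_onD[OF powr_convex[OF assms], of t x y] t xy by auto
  qed
qed auto

text \<open>Upper bounds F and G take the place of the norms, since the induction supplies only
  bounds on the power sums.\<close>

lemma sum_powr_Minkowski:
  fixes f g :: "'a \<Rightarrow> real" and F G p :: real
  assumes p: "1 \<le> p" and D: "finite D"
    and f: "\<And>x. x \<in> D \<Longrightarrow> 0 \<le> f x" and g: "\<And>x. x \<in> D \<Longrightarrow> 0 \<le> g x"
    and FG: "0 \<le> F" "0 \<le> G"
    and sf: "(\<Sum>x\<in>D. f x powr p) \<le> F powr p" and sg: "(\<Sum>x\<in>D. g x powr p) \<le> G powr p"
  shows "(\<Sum>x\<in>D. (f x + g x) powr p) \<le> (F + G) powr p"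
proof -
  have zero: "\<forall>x\<in>D. h x = 0" if "(\<Sum>x\<in>D. h x powr p) \<le> 0 powr p" for h :: "'a \<Rightarrow> real"
  proof -
    have "(\<Sum>x\<in>D. h x powr p) = 0" using that p by (intro antisym sum_nonneg) auto
    then show ?thesis using D by (subst (asm) sum_nonneg_eq_0_iff) auto
  qed
  consider "F = 0" | "G = 0" | "F > 0" "G > 0" using FG by linarith
  then show ?thesis
  proof cases
    case 1
    then have "\<forall>x\<in>D. f x = 0" using sf by (intro zero) simp
    then show ?thesis using 1 sg by simp
  next
    case 2
    then have "\<forall>x\<in>D. g x = 0" using sg by (intro zero) simp
    then show ?thesis using 2 sf by simp
  next
    case 3
    \<comment> \<open>This weight makes f + g equal to (F + G) times the convex combination of f / F
      and g / G, so pointwise convexity can be summed.\<close>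
    define t where "t = G / (F + G)"
    have t: "0 \<le> t" "t \<le> 1" "1 - t = F / (F + G)" using 3 by (auto simp: t_def field_simps)
    have fg_t: "(F + G) * (1 - t) = F" "(F + G) * t = G" using 3 by (simp_all add: t(3)) (simp add: t_def)
    have pt: "(f x + g x) powr p \<le> (F + G) powr p * ((1 - t) * (f x powr p / F powr p) + t * (g x powr p / G powr p))"
      if x: "x \<in> D" for x
    proof -
      have "((1 - t) * (f x / F) + t * (g x / G)) powr p \<le> (1 - t) * (f x / F) powr p + t * (g x / G) powr p"
        using convex_onD[OF convex_on_powr_nonneg[OF p], of t "f x / F" "g x / G"] t f[OF x] g[OF x] 3 by simp
      then have "(F + G) powr p * ((1 - t) * (f x / F) + t * (g x / G)) powr p
          \<le> (F + G) powr p * ((1 - t) * (f x / F) powr p + t * (g x / G) powr p)"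
        by (intro mult_left_mono) auto
      moreover have "f x + g x = (F + G) * ((1 - t) * (f x / F) + t * (g x / G))"
        unfolding distrib_left mult.assoc[symmetric] fg_t using 3 by simp
      ultimately show ?thesis
        by (simp only: powr_mult powr_divide)
    qed
    have "(\<Sum>x\<in>D. (f x + g x) powr p)
        \<le> (\<Sum>x\<in>D. (F + G) powr p * ((1 - t) * (f x powr p / F powr p) + t * (g x powr p / G powr p)))"
      by (intro sum_mono pt)
    also have "\<dots> = (F + G) powr p * ((1 - t) * ((\<Sum>x\<in>D. f x powr p) / F powr p) + t * ((\<Sum>x\<in>D. g x powr p) / G powr p))"
      by (simp only: sum.distrib sum_divide_distrib sum_distrib_left distrib_left)
    also have "\<dots> \<le> (F + G) powr p * ((1 - t) * 1 + t * 1)"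
      using sf sg 3 t(1,2) by (intro mult_left_mono add_mono) (auto simp: divide_simps)
    finally show ?thesis by simp
  qed
qed

text \<open>For a + b > 0 the ratio c / (a + b) is at most 1, so its q-th power is at most the ratio
  itself; add this for c = a and c = b.\<close>

lemma powr_add_le_add_powr:
  fixes a b q :: real
  assumes "1 \<le> q" "0 \<le> a" "0 \<le> b"
  shows "a powr q + b powr q \<le> (a + b) powr q"
proof (cases "a + b = 0")
  case False
  then have ab: "a + b > 0" using assms by auto
  have le: "c powr q \<le> (a + b) powr q * (c / (a + b))" if "0 \<le> c" "c \<le> a + b" for c
  proof -
    have "(c / (a + b)) powr q \<le> (c / (a + b)) powr 1"
      using that assms ab by (intro powr_mono') (auto simp: divide_simps)
    then show ?thesis using that ab by (simp add: powr_divide divide_simps mult.commute)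
  qed
  have "a powr q + b powr q \<le> (a + b) powr q * (a / (a + b)) + (a + b) powr q * (b / (a + b))"
    using assms by (intro add_mono le) auto
  also have "\<dots> = (a + b) powr q"
    using ab by (simp flip: distrib_left add_divide_distrib)
  finally show ?thesis .
next
  case True
  then have "a = 0" "b = 0" using assms by linarith+
  then show ?thesis by simp
qed

section \<open>The four-term inequality\<close>

text \<open>The case t = 0 is the one-variable inequality at s = |qz / \<kappa>|, where \<kappa>s /
  (2q) = |z| / 2 and (2 cosh (z/2))^2 = 2 cosh z + 2. Then \<open>add_cosh_mult_le_powr\<close> with
  W = 2 cosh z brings in t.\<close>

lemma cosh_four_term_le:
  fixes \<kappa> q z t :: real
  assumes \<kappa>: "\<kappa> \<ge> 1" and q: "2 powr \<kappa> + 2 = 2 powr (2 * q)"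
  shows "2 * cosh (q * t) + (2 * cosh (q / \<kappa> * z)) powr \<kappa> \<le> (2 * cosh z + 2 * cosh t) powr q"
proof -
  note b = exponent_bounds[OF \<kappa> q]
  have "(2 * cosh (q / \<kappa> * z)) powr \<kappa> + 2 = (2 * cosh \<bar>q / \<kappa> * z\<bar>) powr \<kappa> + 2"
    by (simp only: cosh_real_abs)
  also have "\<dots> \<le> (2 * cosh (\<kappa> / (2 * q) * \<bar>q / \<kappa> * z\<bar>)) powr (2 * q)"
    by (intro two_cosh_powr_add_two_le \<kappa> q) simp
  also have "\<kappa> / (2 * q) * \<bar>q / \<kappa> * z\<bar> = \<bar>z / 2\<bar>"
    using b \<kappa> by (simp add: abs_mult)
  also have "(2 * cosh \<bar>z / 2\<bar>) powr (2 * q) = ((2 * cosh (z / 2)) powr 2) powr q"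
    by (simp only: cosh_real_abs powr_powr)
  also have "(2 * cosh (z / 2)) powr 2 = 2 * cosh z + 2"
    using cosh_double_cosh[of "z / 2"] by (simp add: power2_eq_square)
  also have "(2 * cosh z + 2) powr q + 2 * cosh (q * t) \<le> (2 * cosh z + 2 * cosh t) powr q + 2"
    by (intro add_cosh_mult_le_powr b) (simp add: cosh_real_ge_1)
  finally show ?thesis by simp
qed

lemma four_term_le:
  fixes \<kappa> q X Y U V :: real
  assumes \<kappa>: "\<kappa> \<ge> 1" and q: "2 powr \<kappa> + 2 = 2 powr (2 * q)"
    and nn: "0 \<le> X" "0 \<le> Y" "0 \<le> U" "0 \<le> V" and XY: "X * Y = U * V"
  shows "U powr q + V powr q + (X powr (q / \<kappa>) + Y powr (q / \<kappa>)) powr \<kappa> \<le> (X + Y + U + V) powr q"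
proof (cases "X * Y = 0")
  case True
  \<comment> \<open>Each pair has at most one nonzero member and (X^(q/\<kappa>))^\<kappa> = X^q, so
    superadditivity of the q-th power is enough.\<close>
  then have "U = 0 \<or> V = 0" "X = 0 \<or> Y = 0" using XY by auto
  then show ?thesis
    using powr_add_le_add_powr[OF exponent_bounds(1)[OF \<kappa> q]] nn \<kappa>
    by (auto simp: powr_powr add.commute)
next
  case False
  then have pos: "X > 0" "Y > 0" "U > 0" "V > 0" using XY nn by (auto simp: less_le)
  define m where "m = (ln X + ln Y) / 2"
  define z where "z = (ln X - ln Y) / 2"
  define t where "t = (ln U - ln V) / 2"
  \<comment> \<open>Equal products give both pairs the same geometric mean exp m; the factor exp(qm)
    then comes out of both sides.\<close>
  have "ln X + ln Y = ln U + ln V" using arg_cong[OF XY, of ln] pos by (simp add: ln_mult)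
  then have e: "ln X = m + z" "ln Y = m - z" "ln U = m + t" "ln V = m - t"
    by (auto simp: m_def z_def t_def field_simps)
  have X: "X = exp (m + z)" "Y = exp (m - z)" "U = exp (m + t)" "V = exp (m - t)"
    using pos by (auto simp flip: e)
  have two: "exp (c * (m + w)) + exp (c * (m - w)) = exp (c * m) * (2 * cosh (c * w))" for c w
    by (simp add: cosh_def algebra_simps flip: exp_add)
  have "U powr q + V powr q + (X powr (q / \<kappa>) + Y powr (q / \<kappa>)) powr \<kappa>
      = exp (q * m) * (2 * cosh (q * t)) + (exp (q / \<kappa> * m) * (2 * cosh (q / \<kappa> * z))) powr \<kappa>"
    unfolding X exp_powr_real two[symmetric] by (simp add: mult.commute)
  also have "\<dots> = exp (q * m) * (2 * cosh (q * t) + (2 * cosh (q / \<kappa> * z)) powr \<kappa>)"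
    using \<kappa> by (simp add: powr_mult exp_powr_real distrib_left)
  also have "\<dots> \<le> exp (q * m) * (2 * cosh z + 2 * cosh t) powr q"
    by (intro mult_left_mono cosh_four_term_le \<kappa> q) auto
  also have "\<dots> = (exp m * (2 * cosh z) + exp m * (2 * cosh t)) powr q"
    by (simp add: powr_mult exp_powr_real mult.commute flip: distrib_left)
  also have "\<dots> = (X + Y + U + V) powr q"
    unfolding X using two[of 1 z] two[of 1 t] by (simp add: add.assoc)
  finally show ?thesis .
qed

section \<open>Representation counts and coordinate boxes\<close>

text \<open>A representation x = a - b is recorded by b alone, as a = b + x is then
  determined.\<close>

definition rep :: "'a::plus set \<Rightarrow> 'a set \<Rightarrow> 'a \<Rightarrow> nat" where
  "rep A B x = card {b \<in> B. b + x \<in> A}"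

lemma rep_eq_0: "(\<And>b. b \<in> B \<Longrightarrow> b + x \<notin> A) \<Longrightarrow> rep A B x = 0"
  unfolding rep_def by (metis (mono_tags, lifting) card.empty empty_Collect_eq)

lemma rep_singleton:
  fixes a b x :: "'a::ab_group_add"
  shows "rep {a} {b} x = (if x = a - b then 1 else 0)"
proof -
  have "{b' \<in> {b}. b' + x \<in> {a}} = (if x = a - b then {b} else {})"
    by (auto simp: algebra_simps)
  then show ?thesis by (simp add: rep_def)
qed

lemma rep_Un_left:
  assumes "finite B" "A \<inter> A' = {}"
  shows "rep (A \<union> A') B x = rep A B x + rep A' B x"
proof -
  have "{b \<in> B. b + x \<in> A \<union> A'} = {b \<in> B. b + x \<in> A} \<union> {b \<in> B. b + x \<in> A'}" by auto
  then show ?thesis using assms unfolding rep_def by (simp add: card_Un_disjoint disjoint_iff)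
qed

lemma rep_Un_right:
  assumes "finite B" "finite B'" "B \<inter> B' = {}"
  shows "rep A (B \<union> B') x = rep A B x + rep A B' x"
proof -
  have "{b \<in> B \<union> B'. b + x \<in> A} = {b \<in> B. b + x \<in> A} \<union> {b \<in> B'. b + x \<in> A}" by auto
  then show ?thesis using assms unfolding rep_def by (simp add: card_Un_disjoint disjoint_iff)
qed

text \<open>Carries cardinality, finiteness and the factorisation of sums of products from
  \<open>PiE\<close> over to boxes of vectors.\<close>

lemma bij_betw_vec_lambda_PiE:
  "bij_betw vec_lambda (Pi\<^sub>E UNIV B) {x :: 'a ^ 'n. \<forall>i. x $ i \<in> B i}"
  by (rule bij_betwI[of _ _ _ vec_nth]) (auto simp: PiE_UNIV_domain)

lemma card_vec_box:
  "card {x :: 'a ^ 'n. \<forall>i. x $ i \<in> B i} = (\<Prod>i\<in>UNIV. card (B i))"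
  using bij_betw_same_card[OF bij_betw_vec_lambda_PiE[of B]] by (simp add: card_PiE)

lemma finite_vec_box:
  "(\<And>i. finite (B i)) \<Longrightarrow> finite {x :: 'a ^ 'n. \<forall>i. x $ i \<in> B i}"
  using bij_betw_finite[OF bij_betw_vec_lambda_PiE[of B]] by (simp add: finite_PiE)

lemma sum_prod_vec_box:
  fixes f :: "'n::finite \<Rightarrow> 'a \<Rightarrow> 'b::comm_semiring_1"
  assumes "\<And>i. finite (B i)"
  shows "(\<Sum>x | \<forall>i. x $ i \<in> B i. \<Prod>i\<in>UNIV. f i (x $ i)) = (\<Prod>i\<in>UNIV. \<Sum>y\<in>B i. f i y)"
  using assms by (simp add: prod_sum_PiE flip: sum.reindex_bij_betw[OF bij_betw_vec_lambda_PiE[of B]])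

lemma finite_cube: "finite (cube :: (int ^ 'n) set)"
  unfolding cube_def by (rule finite_vec_box) simp

lemma card_cube: "card (cube :: (int ^ 'n) set) = 2 ^ CARD('n)"
  unfolding cube_def card_vec_box by (simp add: numeral_2_eq_2)

section \<open>The bilinear bound, by induction on coordinates\<close>

text \<open>S contains every coordinate in which points of A, or points of B, may differ. Inducting
  on S keeps the slices in the same lattice instead of lowering the dimension; two sets are needed
  because different slices get paired.\<close>

lemma sum_rep_powr_le:
  fixes A B D :: "(int ^ 'n) set" and \<kappa> q :: real and S :: "'n set"
  assumes \<kappa>: "\<kappa> \<ge> 1" and q: "2 powr \<kappa> + 2 = 2 powr (2 * q)" and D: "finite D"
    and "A \<subseteq> cube" "B \<subseteq> cube"
    and "\<And>x y i. x \<in> A \<Longrightarrow> y \<in> A \<Longrightarrow> i \<notin> S \<Longrightarrow> x $ i = y $ i"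
    and "\<And>x y i. x \<in> B \<Longrightarrow> y \<in> B \<Longrightarrow> i \<notin> S \<Longrightarrow> x $ i = y $ i"
  shows "(\<Sum>x\<in>D. real (rep A B x) powr \<kappa>) \<le> (real (card A) * real (card B)) powr q"
proof -
  have "finite S" by simp
  then show ?thesis using assms(4-7)
  proof (induction S arbitrary: A B rule: finite_induct)
    case empty
    show ?case
    proof (cases "A = {} \<or> B = {}")
      case True
      then have "rep A B x = 0" for x by (intro rep_eq_0) auto
      then show ?thesis by simp
    next
      case False
      then obtain a b where ab: "a \<in> A" "b \<in> B" by auto
      have "x = a" if "x \<in> A" for x using empty.prems(3)[OF that ab(1)] by (simp add: vec_eq_iff)
      moreover have "x = b" if "x \<in> B" for x using empty.prems(4)[OF that ab(2)] by (simp add: vec_eq_iff)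
      ultimately have AB: "A = {a}" "B = {b}" using ab by blast+
      have "(\<Sum>x\<in>D. real (rep A B x) powr \<kappa>) = (\<Sum>x\<in>D. if x = a - b then 1 else 0)"
        unfolding AB rep_singleton by (intro sum.cong) auto
      also have "\<dots> \<le> 1" using D by simp
      finally show ?thesis unfolding AB by simp
    qed
  next
    case (insert j S)
    define A0 A1 B0 B1 where defs: "A0 = {x \<in> A. x $ j = 0}" "A1 = {x \<in> A. x $ j = 1}"
      "B0 = {x \<in> B. x $ j = 0}" "B1 = {x \<in> B. x $ j = 1}"
    have fin: "finite A" "finite B" using insert.prems(1,2) finite_cube finite_subset by blast+
    have A: "A = A0 \<union> A1" "A0 \<inter> A1 = {}" and B: "B = B0 \<union> B1" "B0 \<inter> B1 = {}"
      using insert.prems(1,2) by (auto simp: defs cube_def)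
    have fin': "finite A0" "finite A1" "finite B0" "finite B1" using fin by (auto simp: defs)
    \<comment> \<open>On a slice the coordinate j is constant as well, so variation is confined to
      the smaller S.\<close>
    have IH: "(\<Sum>x\<in>D. real (rep A' B' x) powr \<kappa>) \<le> (real (card A') * real (card B')) powr q"
      if "A' \<in> {A0, A1}" "B' \<in> {B0, B1}" for A' B'
    proof (rule insert.IH)
      show "A' \<subseteq> cube" "B' \<subseteq> cube" using that insert.prems(1,2) by (auto simp: defs)
      show "x $ i = y $ i" if "x \<in> A'" "y \<in> A'" "i \<notin> S" for x y i
        using that insert.prems(3)[of x y i] \<open>A' \<in> _\<close> by (cases "i = j") (auto simp: defs)
      show "x $ i = y $ i" if "x \<in> B'" "y \<in> B'" "i \<notin> S" for x y i
        using that insert.prems(4)[of x y i] \<open>B' \<in> _\<close> by (cases "i = j") (auto simp: defs)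
    qed
    \<comment> \<open>The exponent q / \<kappa> makes F^\<kappa> and G^\<kappa> the bounds given by
      the induction hypothesis, as Minkowski's inequality requires.\<close>
    define U V F G where UV: "U = real (card A0) * real (card B1)" "V = real (card A1) * real (card B0)"
      "F = (real (card A0) * real (card B0)) powr (q / \<kappa>)" "G = (real (card A1) * real (card B1)) powr (q / \<kappa>)"
    have split: "rep A B x = rep A0 B0 x + rep A0 B1 x + rep A1 B0 x + rep A1 B1 x" for x
      unfolding A(1) B(1) using A(2) B(2) fin' by (simp add: rep_Un_left rep_Un_right)
    have pt: "real (rep A B x) powr \<kappa> \<le> real (rep A0 B1 x) powr \<kappa> + real (rep A1 B0 x) powr \<kappa>
        + (real (rep A0 B0 x) + real (rep A1 B1 x)) powr \<kappa>" for x
    proof -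
      \<comment> \<open>The j-th coordinate of a difference is 0 for the pairs (A0, B0) and (A1,
        B1), -1 for (A0, B1) and 1 for (A1, B0). Only the first two pairs can contribute to the same
        x.\<close>
      have z: "x $ j \<noteq> 0 \<Longrightarrow> rep A0 B0 x = 0" "x $ j \<noteq> 0 \<Longrightarrow> rep A1 B1 x = 0"
        "x $ j \<noteq> -1 \<Longrightarrow> rep A0 B1 x = 0" "x $ j \<noteq> 1 \<Longrightarrow> rep A1 B0 x = 0"
        by (auto intro!: rep_eq_0 simp: defs)
      consider "x $ j = 0" | "x $ j = -1" | "x $ j \<noteq> 0" "x $ j \<noteq> -1" by blast
      then show ?thesis
      proof cases
        case 1
        then show ?thesis unfolding split using z(3,4) by simp
      next
        case 2
        then show ?thesis unfolding split using z(1,2,4) by simp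
      next
        case 3
        then show ?thesis unfolding split using z(1,2,3) by simp
      qed
    qed
    have "(\<Sum>x\<in>D. real (rep A B x) powr \<kappa>) \<le> (\<Sum>x\<in>D. real (rep A0 B1 x) powr \<kappa> + real (rep A1 B0 x) powr \<kappa>
        + (real (rep A0 B0 x) + real (rep A1 B1 x)) powr \<kappa>)"
      by (intro sum_mono pt)
    also have "\<dots> = (\<Sum>x\<in>D. real (rep A0 B1 x) powr \<kappa>) + (\<Sum>x\<in>D. real (rep A1 B0 x) powr \<kappa>)
        + (\<Sum>x\<in>D. (real (rep A0 B0 x) + real (rep A1 B1 x)) powr \<kappa>)"
      by (simp add: sum.distrib)
    also have "\<dots> \<le> U powr q + V powr q + (F + G) powr \<kappa>"
    proof (intro add_mono sum_powr_Minkowski)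
      show "(\<Sum>x\<in>D. real (rep A0 B0 x) powr \<kappa>) \<le> F powr \<kappa>" "(\<Sum>x\<in>D. real (rep A1 B1 x) powr \<kappa>) \<le> G powr \<kappa>"
        using IH[of A0 B0] IH[of A1 B1] \<kappa> by (auto simp: UV powr_powr)
      show "(\<Sum>x\<in>D. real (rep A0 B1 x) powr \<kappa>) \<le> U powr q" "(\<Sum>x\<in>D. real (rep A1 B0 x) powr \<kappa>) \<le> V powr q"
        using IH[of A0 B1] IH[of A1 B0] by (auto simp: UV)
    qed (use \<kappa> D in \<open>auto simp: UV\<close>)
    \<comment> \<open>The constraint XY = UV holds because both products multiply the same four
      cardinalities.\<close>
    also have "\<dots> \<le> (real (card A0) * real (card B0) + real (card A1) * real (card B1) + U + V) powr q"
      unfolding UV by (intro four_term_le \<kappa> q) (auto simp: mult_ac)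
    also have "\<dots> = (real (card A) * real (card B)) powr q"
    proof -
      have "card A = card A0 + card A1" "card B = card B0 + card B1"
        unfolding A(1) B(1) using A(2) B(2) fin' by (simp_all add: card_Un_disjoint)
      then show ?thesis by (simp add: UV algebra_simps)
    qed
    finally show ?case .
  qed
qed

section \<open>The energy as a finite sum, and its value on the cube\<close>

text \<open>The summand is supported on -A, so the infinite sum is finite, and y = -b turns it into
  a count over b in A.\<close>

lemma convolution_indicator_reflection:
  fixes A :: "(int ^ 'n) set"
  assumes "finite A"
  shows "convolution (indicator A) (reflection (indicator A)) x = real (rep A A x)"
proof -
  have "convolution (indicator A) (reflection (indicator A)) x
      = (\<Sum>\<^sub>\<infinity>y\<in>uminus ` A. indicator A (x - y) * indicator A (- y))"
    unfolding convolution_def reflection_def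
    by (rule infsum_cong_neutral) (auto simp: indicator_def image_iff)
  also have "\<dots> = (\<Sum>b\<in>A. indicator A (b + x))"
    using assms by (subst infsum_finite, simp, subst sum.reindex) (auto simp: inj_on_def add.commute indicator_def intro!: sum.cong)
  also have "\<dots> = real (rep A A x)"
    using assms by (simp add: rep_def indicator_def sum.If_cases Int_def)
  finally show ?thesis .
qed

text \<open>D may be any finite set containing all differences, since \<open>rep A A\<close>
  vanishes elsewhere; the outer powers 1 / \<kappa> and \<kappa> cancel.\<close>

lemma energy_eq_sum_rep:
  fixes A D :: "(int ^ 'n) set"
  assumes "\<kappa> \<noteq> 0" "finite A" "finite D" and D: "\<And>a b. a \<in> A \<Longrightarrow> b \<in> A \<Longrightarrow> a - b \<in> D"
  shows "energy \<kappa> A = (\<Sum>x\<in>D. real (rep A A x) powr \<kappa>)"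
proof -
  have "rep A A x = 0" if "x \<notin> D" for x
    using that D[of "b + x" b for b] by (intro rep_eq_0) auto
  then have "(\<Sum>\<^sub>\<infinity>x. real (rep A A x) powr \<kappa>) = (\<Sum>\<^sub>\<infinity>x\<in>D. real (rep A A x) powr \<kappa>)"
    by (intro infsum_cong_neutral) auto
  then show ?thesis using assms
    by (simp add: energy_def lp_norm_def convolution_indicator_reflection powr_powr sum_nonneg)
qed

lemma rep_cube:
  "rep cube cube (x :: int ^ 'n) = (\<Prod>i\<in>UNIV. card {b \<in> {0, 1}. b + x $ i \<in> {0, 1}})"
proof -
  have "{b \<in> cube. b + x \<in> cube} = {b :: int ^ 'n. \<forall>i. b $ i \<in> {b \<in> {0, 1}. b + x $ i \<in> {0, 1}}}"
    by (auto simp: cube_def)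
  then show ?thesis unfolding rep_def by (simp only: card_vec_box)
qed

text \<open>Both the box {-1, 0, 1}^d and the count \<open>rep cube cube\<close> factor over
  coordinates. Each coordinate contributes 2^\<kappa> + 1 + 1, from the differences 0, 1 and
  -1.\<close>

lemma energy_cube:
  assumes "\<kappa> \<noteq> 0"
  shows "energy \<kappa> (cube :: (int ^ 'n) set) = (2 powr \<kappa> + 2) ^ CARD('n)"
proof -
  define c where "c y = card {b \<in> {0, 1}. b + y \<in> {0, 1}}" for y :: int
  have "{b \<in> {0, 1}. b + 0 \<in> {0, 1 :: int}} = {0, 1}" "{b \<in> {0, 1}. b + 1 \<in> {0, 1 :: int}} = {0}"
    "{b \<in> {0, 1}. b + - 1 \<in> {0, 1 :: int}} = {1}" by auto
  then have c: "c 0 = 2" "c 1 = 1" "c (-1) = 1" unfolding c_def by simp_all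
  have "energy \<kappa> (cube :: (int ^ 'n) set)
      = (\<Sum>x | \<forall>i. (x :: int ^ 'n) $ i \<in> {-1, 0, 1}. real (rep cube cube x) powr \<kappa>)"
  proof (rule energy_eq_sum_rep[OF assms finite_cube])
    show "finite {x :: int ^ 'n. \<forall>i. x $ i \<in> {-1, 0, 1}}" by (rule finite_vec_box) simp
    fix a b :: "int ^ 'n" assume ab: "a \<in> cube" "b \<in> cube"
    have "a $ i - b $ i \<in> {-1, 0, 1}" for i
      using ab[unfolded cube_def mem_Collect_eq, THEN spec, of i] by auto
    then show "a - b \<in> {x. \<forall>i. x $ i \<in> {-1, 0, 1}}" by simp
  qed
  also have "\<dots> = (\<Sum>x | \<forall>i. (x :: int ^ 'n) $ i \<in> {-1, 0, 1}. \<Prod>i\<in>UNIV. real (c (x $ i)) powr \<kappa>)"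
    unfolding rep_cube c_def of_nat_prod prod_powr_distrib ..
  also have "\<dots> = (\<Prod>i\<in>(UNIV :: 'n set). \<Sum>y\<in>{-1, 0, 1}. real (c y) powr \<kappa>)"
    by (rule sum_prod_vec_box) simp
  also have "(\<Sum>y\<in>{-1, 0, 1}. real (c y) powr \<kappa>) = 2 powr \<kappa> + 2"
    by (simp add: c)
  finally show ?thesis by simp
qed

theorem corollary7:
  fixes \<kappa> :: real
  assumes "\<kappa> \<ge> 1"
  shows "(\<forall>A :: (int ^ 'n) set. A \<subseteq> cube \<longrightarrow>
            energy \<kappa> A \<le> real (card A) powr r_exponent \<kappa>)
       \<and> (\<forall>A :: (int ^ 'n) set. A \<subseteq> cube \<and> card A \<le> 1 \<longrightarrow>
            energy \<kappa> A = real (card A) powr r_exponent \<kappa>)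
       \<and> card (cube :: (int ^ 'n) set) > 1
       \<and> energy \<kappa> (cube :: (int ^ 'n) set)
            = real (card (cube :: (int ^ 'n) set)) powr r_exponent \<kappa>"
proof (intro conjI allI impI)
  define q where "q = r_exponent \<kappa> / 2"
  have r: "2 powr r_exponent \<kappa> = 2 powr \<kappa> + 2"
    unfolding r_exponent_def by (rule powr_log_cancel) (auto simp: add_pos_pos)
  then have q: "2 powr \<kappa> + 2 = 2 powr (2 * q)" by (simp add: q_def)
  {
    fix A :: "(int ^ 'n) set" assume A: "A \<subseteq> cube"
    have fin: "finite A" using A finite_cube finite_subset by blast
    let ?D = "(\<lambda>(a, b). a - b) ` (A \<times> A)"
    have "energy \<kappa> A = (\<Sum>x\<in>?D. real (rep A A x) powr \<kappa>)"
      using assms fin by (intro energy_eq_sum_rep) auto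
    also have "\<dots> \<le> (real (card A) * real (card A)) powr q"
      \<comment> \<open>With S = UNIV the conditions on coordinates outside S are vacuous.\<close>
      by (rule sum_rep_powr_le[OF assms q, where S = UNIV]) (use A fin in auto)
    also have "\<dots> = real (card A) powr r_exponent \<kappa>"
      by (simp add: powr_mult q_def flip: powr_add)
    finally show "energy \<kappa> A \<le> real (card A) powr r_exponent \<kappa>" .
  next
    fix A :: "(int ^ 'n) set" assume A: "A \<subseteq> cube \<and> card A \<le> 1"
    then have fin: "finite A" using finite_cube finite_subset by blast
    show "energy \<kappa> A = real (card A) powr r_exponent \<kappa>"
    proof (cases "A = {}")
      case True
      \<comment> \<open>Both sides are 0 here, the right one because \<open>0 powr r = 0\<close> for
        every r.\<close>
      then show ?thesis using assms energy_eq_sum_rep[of \<kappa> A "{}"] by simp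
    next
      case False
      with A fin have "card A = 1" by (simp add: le_Suc_eq)
      then obtain a where "A = {a}" by (auto simp: card_1_singleton_iff)
      then show ?thesis using assms energy_eq_sum_rep[of \<kappa> A "{0}"] by (simp add: rep_singleton)
    qed
  next
    show "card (cube :: (int ^ 'n) set) > 1"
      unfolding card_cube by (rule one_less_power) simp_all
  next
    \<comment> \<open>Exchange the exponents, (2^d)^r = (2^r)^d, and recall that 2^r = 2^\<kappa> +
      2.\<close>
    have "real (card (cube :: (int ^ 'n) set)) powr r_exponent \<kappa> = (2 powr r_exponent \<kappa>) ^ CARD('n)"
      by (simp add: card_cube powr_power powr_powr mult.commute flip: powr_realpow)
    then show "energy \<kappa> (cube :: (int ^ 'n) set) = real (card (cube :: (int ^ 'n) set)) powr r_exponent \<kappa>"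
      using assms by (simp add: energy_cube r)
  }
qed

end
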